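(* Let $A$ be a (unital, not necessarily associative) ring with involution $*$, let $\alpha$ be an invertible symmetric ($\alpha^*=\alpha$) element of the center of $A$, and let $R=(A,\alpha)$ be the ring obtained from $A$ by the Cayley-Dickson process. Put $C=Z(A)$, $I=\operatorname{Ann}_C([A,A])$, $B=\{a\in C : a=a^*\}$ and $J=\operatorname{Ann}_B(\{a-a^* : a\in A\})$. Then: (1) $Z(R)=\{(x,y) : x\in B\cap C,\ y\in I\cap J\}$. (2) The ring $R$ is centrally essential if and only if $B$ is an essential $B$-submodule of the module ${}_BA$ and $J$ is an essential ideal of the ring $B$.
   Context: All rings are unital but not necessarily associative. An involution $*$ of a ring $A$ is an additive map with $(ab)^*=b^*a^*$ and $(a^* )^*=a$. For a ring $R$, $(a,b,c)=(ab)c-a(bc)$ is the associator and $[a,b]=ab-ba$ the commutator. The associative center is $N(R)=\{x\in R : (x,a,b)=(a,x,b)=(a,b,x)=0\ \forall a,b\in R\}$, the commutative center is $K(R)=\{x\in R : [x,a]=0\ \forall a\in R\}$, and the center is $Z(R)=N(R)\cap K(R)$, a subring of $R$. $[A,A]$ denotes the (two-sided) ideal of $A$ generated by the commutators of all its elements. For a subring $D$ of the center of $A$ and a subset $S$ of $A$, $\operatorname{Ann}_D(S)=\{d\in D : dS=0\}$. Cayley-Dickson process: $(A,\alpha)$ is the abelian group $A\oplus A$ with multiplication $$(a_1,a_2)(a_3,a_4)=(a_1a_3+\alpha a_4a_2^*,\ a_1^*a_4+a_3a_2).$$ A ring $R$ is centrally essential if $Z(R)r\cap Z(R)\neq 0$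 for every nonzero $r\in R$. A submodule is essential if it has nonzero intersection with every nonzero submodule; likewise for ideals of a commutative ring. *)

theory Defs
  imports "HOL-Algebra.Module" "HOL-Algebra.Ideal"
begin

text \<open>
  The locale \<^locale>\<open>ring\<close> of HOL-Algebra is associative; only its record type is reused here.
  The zero ring is allowed, as in \<^locale>\<open>ring\<close>.
\<close>

locale nonassoc_ring = abelian_group R for R (structure) +
  assumes m_closed [simp, intro]:
      "\<lbrakk>x \<in> carrier R; y \<in> carrier R\<rbrakk> \<Longrightarrow> x \<otimes> y \<in> carrier R"
    and one_closed [simp, intro]: "\<one> \<in> carrier R"
    and l_one [simp]: "x \<in> carrier R \<Longrightarrow> \<one> \<otimes> x = x"
    and r_one [simp]: "x \<in> carrier R \<Longrightarrow> x \<otimes> \<one> = x"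
    and l_distr: "\<lbrakk>x \<in> carrier R; y \<in> carrier R; z \<in> carrier R\<rbrakk>
      \<Longrightarrow> (x \<oplus> y) \<otimes> z = x \<otimes> z \<oplus> y \<otimes> z"
    and r_distr: "\<lbrakk>x \<in> carrier R; y \<in> carrier R; z \<in> carrier R\<rbrakk>
      \<Longrightarrow> z \<otimes> (x \<oplus> y) = z \<otimes> x \<oplus> z \<otimes> y"

locale ring_involution = nonassoc_ring A for A (structure) and s :: "'a \<Rightarrow> 'a" +
  assumes inv_closed [simp, intro]: "a \<in> carrier A \<Longrightarrow> s a \<in> carrier A"
    and inv_add: "\<lbrakk>a \<in> carrier A; b \<in> carrier A\<rbrakk> \<Longrightarrow> s (a \<oplus> b) = s a \<oplus> s b"
    and inv_mult: "\<lbrakk>a \<in> carrier A; b \<in> carrier A\<rbrakk> \<Longrightarrow> s (a \<otimes> b) = s b \<otimes> s a"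
    and inv_inv [simp]: "a \<in> carrier A \<Longrightarrow> s (s a) = a"

definition associator :: "('a, 'm) ring_scheme \<Rightarrow> 'a \<Rightarrow> 'a \<Rightarrow> 'a \<Rightarrow> 'a" where
  "associator R a b c = (a \<otimes>\<^bsub>R\<^esub> b) \<otimes>\<^bsub>R\<^esub> c \<ominus>\<^bsub>R\<^esub> a \<otimes>\<^bsub>R\<^esub> (b \<otimes>\<^bsub>R\<^esub> c)"

definition commutator :: "('a, 'm) ring_scheme \<Rightarrow> 'a \<Rightarrow> 'a \<Rightarrow> 'a" where
  "commutator R a b = a \<otimes>\<^bsub>R\<^esub> b \<ominus>\<^bsub>R\<^esub> b \<otimes>\<^bsub>R\<^esub> a"

definition associative_center :: "('a, 'm) ring_scheme \<Rightarrow> 'a set" where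
  "associative_center R = {x \<in> carrier R. \<forall>a\<in>carrier R. \<forall>b\<in>carrier R.
     associator R x a b = \<zero>\<^bsub>R\<^esub> \<and> associator R a x b = \<zero>\<^bsub>R\<^esub> \<and> associator R a b x = \<zero>\<^bsub>R\<^esub>}"

definition commutative_center :: "('a, 'm) ring_scheme \<Rightarrow> 'a set" where
  "commutative_center R = {x \<in> carrier R. \<forall>a\<in>carrier R. commutator R x a = \<zero>\<^bsub>R\<^esub>}"

definition ring_center :: "('a, 'm) ring_scheme \<Rightarrow> 'a set" where
  "ring_center R = associative_center R \<inter> commutative_center R"

text \<open>The locale \<^locale>\<open>ideal\<close> cannot be used in \<open>A\<close>, since it assumes associativity.\<close>

locale nonassoc_ideal = additive_subgroup K R + nonassoc_ring R for K and R (structure) +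
  assumes ideal_l_closed: "\<lbrakk>a \<in> K; x \<in> carrier R\<rbrakk> \<Longrightarrow> x \<otimes> a \<in> K"
    and ideal_r_closed: "\<lbrakk>a \<in> K; x \<in> carrier R\<rbrakk> \<Longrightarrow> a \<otimes> x \<in> K"

definition commutator_ideal :: "('a, 'm) ring_scheme \<Rightarrow> 'a set" where
  "commutator_ideal R = \<Inter>{K. nonassoc_ideal K R \<and>
     {commutator R a b | a b. a \<in> carrier R \<and> b \<in> carrier R} \<subseteq> K}"

definition annihilator :: "('a, 'm) ring_scheme \<Rightarrow> 'a set \<Rightarrow> 'a set \<Rightarrow> 'a set" where
  "annihilator R D S = {d \<in> D. \<forall>s\<in>S. d \<otimes>\<^bsub>R\<^esub> s = \<zero>\<^bsub>R\<^esub>}"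

definition cayley_dickson ::
  "('a, 'm) ring_scheme \<Rightarrow> ('a \<Rightarrow> 'a) \<Rightarrow> 'a \<Rightarrow> ('a \<times> 'a) ring" where
  "cayley_dickson A s \<alpha> =
    \<lparr>carrier = carrier A \<times> carrier A,
     mult = (\<lambda>(a1, a2) (a3, a4).
       (a1 \<otimes>\<^bsub>A\<^esub> a3 \<oplus>\<^bsub>A\<^esub> \<alpha> \<otimes>\<^bsub>A\<^esub> (a4 \<otimes>\<^bsub>A\<^esub> s a2), s a1 \<otimes>\<^bsub>A\<^esub> a4 \<oplus>\<^bsub>A\<^esub> a3 \<otimes>\<^bsub>A\<^esub> a2)),
     one = (\<one>\<^bsub>A\<^esub>, \<zero>\<^bsub>A\<^esub>),
     zero = (\<zero>\<^bsub>A\<^esub>, \<zero>\<^bsub>A\<^esub>),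
     add = (\<lambda>(a1, a2) (a3, a4). (a1 \<oplus>\<^bsub>A\<^esub> a3, a2 \<oplus>\<^bsub>A\<^esub> a4))\<rparr>"

definition centrally_essential :: "('a, 'm) ring_scheme \<Rightarrow> bool" where
  "centrally_essential R \<longleftrightarrow> (\<forall>r\<in>carrier R. r \<noteq> \<zero>\<^bsub>R\<^esub> \<longrightarrow>
     {z \<otimes>\<^bsub>R\<^esub> r | z. z \<in> ring_center R} \<inter> ring_center R \<noteq> {\<zero>\<^bsub>R\<^esub>})"

definition essential_submodule ::
  "('r, 'm) ring_scheme \<Rightarrow> ('r, 'a, 'n) module_scheme \<Rightarrow> 'a set \<Rightarrow> bool" where
  "essential_submodule R M N \<longleftrightarrow> submodule N R M \<and>
     (\<forall>K. submodule K R M \<longrightarrow> K \<noteq> {\<zero>\<^bsub>M\<^esub>} \<longrightarrow> N \<inter> K \<noteq> {\<zero>\<^bsub>M\<^esub>})"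

definition essential_ideal :: "('r, 'm) ring_scheme \<Rightarrow> 'r set \<Rightarrow> bool" where
  "essential_ideal R N \<longleftrightarrow> ideal N R \<and>
     (\<forall>K. ideal K R \<longrightarrow> K \<noteq> {\<zero>\<^bsub>R\<^esub>} \<longrightarrow> N \<inter> K \<noteq> {\<zero>\<^bsub>R\<^esub>})"

text \<open>
  \<open>A\<close> as a left module over itself; it becomes the module \<open>\<^sub>BA\<close> when the scalars
  are taken from the ring \<open>A\<lparr>carrier := B\<rparr>\<close>.
\<close>

definition regular_module :: "('a, 'm) ring_scheme \<Rightarrow> ('a, 'a) module" where
  "regular_module A = \<lparr>carrier = carrier A, mult = mult A, one = \<one>\<^bsub>A\<^esub>,
     zero = \<zero>\<^bsub>A\<^esub>, add = add A, smult = mult A\<rparr>"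

definition symmetric_center :: "('a, 'm) ring_scheme \<Rightarrow> ('a \<Rightarrow> 'a) \<Rightarrow> 'a set" where
  "symmetric_center A s = {a \<in> ring_center A. a = s a}"


lemma (in ring_involution) inv_zero [simp]: "s \<zero> = \<zero>"
  by (metis add.r_cancel_one' inv_add inv_closed l_zero zero_closed)

lemma (in ring_involution) inv_one [simp]: "s \<one> = \<one>"
  by (metis inv_closed inv_inv inv_mult l_one one_closed r_one)

lemma (in ring_involution) inv_a_inv: "a \<in> carrier A \<Longrightarrow> s (\<ominus> a) = \<ominus> s a"
  by (metis a_inv_closed inv_add inv_closed inv_zero l_neg minus_equality)

lemma (in nonassoc_ring) r_null [simp]: "x \<in> carrier R \<Longrightarrow> x \<otimes> \<zero> = \<zero>"
  by (metis add.r_cancel_one' m_closed r_distr r_zero zero_closed)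

lemma (in nonassoc_ring) l_null [simp]: "x \<in> carrier R \<Longrightarrow> \<zero> \<otimes> x = \<zero>"
  by (metis add.r_cancel_one' m_closed l_distr r_zero zero_closed)

lemma (in nonassoc_ring) l_minus: "\<lbrakk>x \<in> carrier R; y \<in> carrier R\<rbrakk> \<Longrightarrow> \<ominus> x \<otimes> y = \<ominus> (x \<otimes> y)"
  by (metis a_inv_closed l_distr l_neg l_null m_closed minus_equality)

lemma (in nonassoc_ring) r_minus: "\<lbrakk>x \<in> carrier R; y \<in> carrier R\<rbrakk> \<Longrightarrow> x \<otimes> \<ominus> y = \<ominus> (x \<otimes> y)"
  by (metis a_inv_closed r_distr l_neg r_null m_closed minus_equality)

lemma (in nonassoc_ring) mem_ring_center:
  "x \<in> ring_center R \<longleftrightarrow> x \<in> carrier R \<and> (\<forall>a\<in>carrier R. x \<otimes> a = a \<otimes> x) \<and>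
    (\<forall>a\<in>carrier R. \<forall>b\<in>carrier R. (x \<otimes> a) \<otimes> b = x \<otimes> (a \<otimes> b) \<and>
       (a \<otimes> x) \<otimes> b = a \<otimes> (x \<otimes> b) \<and> (a \<otimes> b) \<otimes> x = a \<otimes> (b \<otimes> x))"
proof -
  have *: "\<lbrakk>u \<in> carrier R; v \<in> carrier R\<rbrakk> \<Longrightarrow> u \<ominus> v = \<zero> \<longleftrightarrow> u = v" for u v
    by (metis a_minus_def minus_equality minus_minus a_inv_closed r_neg)
  have A: "associator R u v w = \<zero> \<longleftrightarrow> (u \<otimes> v) \<otimes> w = u \<otimes> (v \<otimes> w)"
    if "u \<in> carrier R" "v \<in> carrier R" "w \<in> carrier R" for u v w
    unfolding associator_def using that by (intro *) auto
  have C: "commutator R u v = \<zero> \<longleftrightarrow> u \<otimes> v = v \<otimes> u"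
    if "u \<in> carrier R" "v \<in> carrier R" for u v
    unfolding commutator_def using that by (intro *) auto
  show ?thesis
    unfolding ring_center_def associative_center_def commutative_center_def Int_iff mem_Collect_eq
    using A C by blast
qed

lemma (in ring_involution) nonassoc_ring_cayley_dickson:
  assumes "\<alpha> \<in> carrier A"
  shows "nonassoc_ring (cayley_dickson A s \<alpha>)"
proof (intro nonassoc_ring.intro abelian_groupI nonassoc_ring_axioms.intro)
  fix x assume "x \<in> carrier (cayley_dickson A s \<alpha>)"
  then show "\<exists>y\<in>carrier (cayley_dickson A s \<alpha>).
      y \<oplus>\<^bsub>cayley_dickson A s \<alpha>\<^esub> x = \<zero>\<^bsub>cayley_dickson A s \<alpha>\<^esub>"
    by (intro bexI[of _ "(\<ominus> fst x, \<ominus> snd x)"]) (auto simp: cayley_dickson_def l_neg)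
qed (use assms in \<open>auto simp: cayley_dickson_def a_ac l_distr r_distr inv_add\<close>)

lemma (in ring_involution) cring_symmetric_center:
  "cring (A\<lparr>carrier := symmetric_center A s\<rparr>)"
proof -
  let ?B = "symmetric_center A s"
  have B: "x \<in> ?B \<longleftrightarrow> x \<in> ring_center A \<and> s x = x" for x
    by (auto simp: symmetric_center_def)
  have c: "x \<in> ?B \<Longrightarrow> x \<in> carrier A" for x
    by (simp add: B mem_ring_center)
  have cc: "a \<otimes> x = x \<otimes> a" if "x \<in> ?B" "a \<in> carrier A" for x a
    using that by (simp add: B mem_ring_center)
  have ca: "(x \<otimes> a) \<otimes> b = x \<otimes> (a \<otimes> b)" "(a \<otimes> x) \<otimes> b = a \<otimes> (x \<otimes> b)"
    "(a \<otimes> b) \<otimes> x = a \<otimes> (b \<otimes> x)" if "x \<in> ?B" "a \<in> carrier A" "b \<in> carrier A" for x a b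
    using that unfolding B mem_ring_center by blast+
  have add: "x \<oplus> y \<in> ?B" if "x \<in> ?B" "y \<in> ?B" for x y
    unfolding B mem_ring_center
    using that c[OF that(1)] c[OF that(2)] B[of x] B[of y]
    by (simp add: l_distr r_distr inv_add ca) (metis cc that)
  have neg: "\<ominus> x \<in> ?B" if "x \<in> ?B" for x
    unfolding B mem_ring_center
    using that c[OF that(1)] B[of x] by (simp add: l_minus r_minus inv_a_inv ca) (metis cc that)
  have mult: "x \<otimes> y \<in> ?B" if "x \<in> ?B" "y \<in> ?B" for x y
  proof -
    have x: "x \<in> carrier A" "\<And>a. a \<in> carrier A \<Longrightarrow> a \<otimes> x = x \<otimes> a" "s x = x"
      "\<And>a b. \<lbrakk>a \<in> carrier A; b \<in> carrier A\<rbrakk> \<Longrightarrow> (x \<otimes> a) \<otimes> b = x \<otimes> (a \<otimes> b)"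
      "\<And>a b. \<lbrakk>a \<in> carrier A; b \<in> carrier A\<rbrakk> \<Longrightarrow> a \<otimes> (x \<otimes> b) = x \<otimes> (a \<otimes> b)"
      using that(1) unfolding B mem_ring_center by (blast, metis, blast, blast, metis)
    have y: "y \<in> carrier A" "\<And>a. a \<in> carrier A \<Longrightarrow> a \<otimes> y = y \<otimes> a" "s y = y"
      "\<And>a b. \<lbrakk>a \<in> carrier A; b \<in> carrier A\<rbrakk> \<Longrightarrow> (y \<otimes> a) \<otimes> b = y \<otimes> (a \<otimes> b)"
      "\<And>a b. \<lbrakk>a \<in> carrier A; b \<in> carrier A\<rbrakk> \<Longrightarrow> a \<otimes> (y \<otimes> b) = y \<otimes> (a \<otimes> b)"
      using that(2) unfolding B mem_ring_center by (blast, metis, blast, blast, metis)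
    have "s (x \<otimes> y) = x \<otimes> y" by (simp add: inv_mult x(1,3) y(1,3) x(2)[OF y(1)])
    moreover have "x \<otimes> y \<in> ring_center A"
      unfolding mem_ring_center
    proof (intro conjI ballI)
      fix a b assume ab: "a \<in> carrier A" "b \<in> carrier A"
      show "x \<otimes> y \<otimes> a \<otimes> b = x \<otimes> y \<otimes> (a \<otimes> b)"
        by (simp add: x(1,4) y(1,4) ab)
      have "a \<otimes> (x \<otimes> y) = x \<otimes> (y \<otimes> a)"
        by (simp only: x(5) ab y(1) y(2)[OF ab(1)])
      then show "a \<otimes> (x \<otimes> y) \<otimes> b = a \<otimes> (x \<otimes> y \<otimes> b)"
        by (simp add: x(1,4,5) y(1,4) y(5)[OF ab] ab)
      have "a \<otimes> b \<otimes> (x \<otimes> y) = x \<otimes> (y \<otimes> (a \<otimes> b))"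
        by (simp add: x(5) y(1) ab y(2)[of "a \<otimes> b"])
      moreover have "a \<otimes> (b \<otimes> (x \<otimes> y)) = x \<otimes> (y \<otimes> (a \<otimes> b))"
        by (simp add: x(5) y(1) ab y(2)[OF ab(2)] y(5)[OF ab])
      ultimately show "a \<otimes> b \<otimes> (x \<otimes> y) = a \<otimes> (b \<otimes> (x \<otimes> y))" by simp
    next
      fix a assume a: "a \<in> carrier A"
      show "x \<otimes> y \<otimes> a = a \<otimes> (x \<otimes> y)"
        by (simp add: x(4,5) y(1) a y(2)[OF a])
    qed (simp add: x(1) y(1))
    ultimately show ?thesis by (simp add: B)
  qed
  have zero: "\<zero> \<in> ?B" and one: "\<one> \<in> ?B"
    by (simp_all add: B mem_ring_center)
  show ?thesis
  proof (intro cringI abelian_groupI comm_monoidI)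
    fix x assume "x \<in> carrier (A\<lparr>carrier := ?B\<rparr>)"
    then show "\<exists>y\<in>carrier (A\<lparr>carrier := ?B\<rparr>). y \<oplus>\<^bsub>A\<lparr>carrier := ?B\<rparr>\<^esub> x = \<zero>\<^bsub>A\<lparr>carrier := ?B\<rparr>\<^esub>"
      using neg by (intro bexI[of _ "\<ominus> x"]) (auto simp: c l_neg)
  next
    fix x y assume "x \<in> carrier (A\<lparr>carrier := ?B\<rparr>)" "y \<in> carrier (A\<lparr>carrier := ?B\<rparr>)"
    then have "x \<in> ?B" "y \<in> ?B" by simp_all
    then have "x \<otimes> y = y \<otimes> x" using cc[of y x] c[of x] by blast
    then show "x \<otimes>\<^bsub>A\<lparr>carrier := ?B\<rparr>\<^esub> y = y \<otimes>\<^bsub>A\<lparr>carrier := ?B\<rparr>\<^esub> x"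
      by simp
  next
    fix x y z assume "x \<in> carrier (A\<lparr>carrier := ?B\<rparr>)" "y \<in> carrier (A\<lparr>carrier := ?B\<rparr>)"
      "z \<in> carrier (A\<lparr>carrier := ?B\<rparr>)"
    then show "x \<otimes>\<^bsub>A\<lparr>carrier := ?B\<rparr>\<^esub> y \<otimes>\<^bsub>A\<lparr>carrier := ?B\<rparr>\<^esub> z =
        x \<otimes>\<^bsub>A\<lparr>carrier := ?B\<rparr>\<^esub> (y \<otimes>\<^bsub>A\<lparr>carrier := ?B\<rparr>\<^esub> z)"
      using c ca(1)[of x y z] by simp
  qed (auto simp: add mult zero one c a_ac l_distr)
qed

lemma (in ring_involution) module_regular_module:
  "module (A\<lparr>carrier := symmetric_center A s\<rparr>) (regular_module A)"
proof -
  have c: "x \<in> symmetric_center A s \<Longrightarrow> x \<in> carrier A" for x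
    by (simp add: symmetric_center_def mem_ring_center)
  show ?thesis
  proof (intro moduleI cring_symmetric_center abelian_groupI)
    fix x assume "x \<in> carrier (regular_module A)"
    then show "\<exists>y\<in>carrier (regular_module A).
        y \<oplus>\<^bsub>regular_module A\<^esub> x = \<zero>\<^bsub>regular_module A\<^esub>"
      by (intro bexI[of _ "\<ominus> x"]) (auto simp: regular_module_def l_neg)
  next
    fix a b x
    assume "a \<in> carrier (A\<lparr>carrier := symmetric_center A s\<rparr>)"
      "b \<in> carrier (A\<lparr>carrier := symmetric_center A s\<rparr>)" "x \<in> carrier (regular_module A)"
    then have "a \<in> ring_center A" "b \<in> carrier A" "x \<in> carrier A"
      by (simp_all add: regular_module_def symmetric_center_def mem_ring_center)
    then have "a \<otimes> b \<otimes> x = a \<otimes> (b \<otimes> x)" unfolding mem_ring_center by blast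
    then show "(a \<otimes>\<^bsub>A\<lparr>carrier := symmetric_center A s\<rparr>\<^esub> b) \<odot>\<^bsub>regular_module A\<^esub> x =
        a \<odot>\<^bsub>regular_module A\<^esub> (b \<odot>\<^bsub>regular_module A\<^esub> x)"
      by (simp add: regular_module_def)
  qed (use c in \<open>auto simp: regular_module_def a_ac l_distr r_distr\<close>)
qed

end

theory Submission
  imports Defs
begin

text \<open>
  Comparing products of \<open>(x, y)\<close> with \<open>(a, 0)\<close> and \<open>(0, b)\<close> shows that a central \<open>(x, y)\<close> has
  \<open>x \<in> B\<close> and \<open>y \<in> J\<close>. For \<open>y \<in> J\<close> one has \<open>y (a b) = y (b\<^sup>* a\<^sup>*) = y (b a)\<close>, so \<open>J \<subseteq> I\<close> and
  \<open>Z(R) = B \<times> J\<close>. Central essentiality of \<open>R\<close>, tested on \<open>(a, 0)\<close> and \<open>(0, b)\<close>, gives the two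
  essentiality conditions. Conversely, those conditions let every nonzero \<open>a \<in> A\<close> be scaled by some
  \<open>x \<in> B\<close> to a nonzero \<open>x a \<in> J\<close>; doing this first for \<open>a\<close> and then for the second component
  moves \<open>(a, b)\<close> into \<open>J \<times> J\<close> by a scalar \<open>(x, 0)\<close> without killing it.
\<close>

section \<open>Calculus with central elements of a nonassociative ring\<close>

context nonassoc_ring
begin

lemma center_closed: "x \<in> ring_center R \<Longrightarrow> x \<in> carrier R"
  by (simp add: mem_ring_center)

lemma center_comm: "\<lbrakk>x \<in> ring_center R; a \<in> carrier R\<rbrakk> \<Longrightarrow> a \<otimes> x = x \<otimes> a"
  by (simp add: mem_ring_center)

text \<open>Read from left to right, these rules bring every product of \<open>a\<close>,
  \<open>b\<close> and one central factor to the normal form with that factor in front.\<close>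

lemma center_assoc:
  assumes "x \<in> ring_center R" "a \<in> carrier R" "b \<in> carrier R"
  shows "x \<otimes> a \<otimes> b = x \<otimes> (a \<otimes> b)"
    and "a \<otimes> x \<otimes> b = x \<otimes> (a \<otimes> b)"
    and "a \<otimes> b \<otimes> x = x \<otimes> (a \<otimes> b)"
    and "a \<otimes> (x \<otimes> b) = x \<otimes> (a \<otimes> b)"
    and "a \<otimes> (b \<otimes> x) = x \<otimes> (a \<otimes> b)"
proof -
  have 1: "x \<otimes> a \<otimes> b = x \<otimes> (a \<otimes> b)" "a \<otimes> x \<otimes> b = a \<otimes> (x \<otimes> b)"
    "a \<otimes> b \<otimes> x = a \<otimes> (b \<otimes> x)"
    using assms unfolding mem_ring_center by blast+
  show "x \<otimes> a \<otimes> b = x \<otimes> (a \<otimes> b)" by (rule 1)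
  show 2: "a \<otimes> b \<otimes> x = x \<otimes> (a \<otimes> b)"
    using assms by (simp add: center_comm)
  show "a \<otimes> (b \<otimes> x) = x \<otimes> (a \<otimes> b)" using 1 2 by simp
  show "a \<otimes> x \<otimes> b = x \<otimes> (a \<otimes> b)" using 1 center_comm[OF assms(1,2)] by simp
  then show "a \<otimes> (x \<otimes> b) = x \<otimes> (a \<otimes> b)" using 1 by simp
qed

lemma minus_eq_zero_iff:
  assumes "u \<in> carrier R" "v \<in> carrier R"
  shows "u \<ominus> v = \<zero> \<longleftrightarrow> u = v"
  by (metis a_minus_def a_inv_closed assms minus_equality minus_minus r_neg)

lemma mult_minus_distr:
  assumes "u \<in> carrier R" "v \<in> carrier R" "y \<in> carrier R"
  shows "y \<otimes> (u \<ominus> v) = y \<otimes> u \<ominus> y \<otimes> v"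
  using assms by (simp add: a_minus_def r_distr r_minus)

text \<open>This replaces annihilation of the commutator ideal, given only as an intersection of
  ideals, by an identity on products of two elements.\<close>

lemma center_annihilates_commutator_ideal:
  assumes y: "y \<in> ring_center R"
    and comm: "\<And>a b. \<lbrakk>a \<in> carrier R; b \<in> carrier R\<rbrakk> \<Longrightarrow> y \<otimes> (a \<otimes> b) = y \<otimes> (b \<otimes> a)"
  shows "y \<in> annihilator R (ring_center R) (commutator_ideal R)"
proof -
  have yc: "y \<in> carrier R" using y by (rule center_closed)
  let ?K = "{u \<in> carrier R. y \<otimes> u = \<zero>}"
  \<comment> \<open>\<open>[R, R]\<close> lies in the kernel of multiplication by \<open>y\<close>, which is an ideal because \<open>y\<close> is central.\<close>
  have "nonassoc_ideal ?K R"
  proof (intro nonassoc_ideal.intro nonassoc_ideal_axioms.intro)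
    show "additive_subgroup ?K R"
    proof (intro additive_subgroup.intro)
      show "subgroup ?K (add_monoid R)"
      proof
        fix u assume "u \<in> ?K"
        then show "inv\<^bsub>add_monoid R\<^esub> u \<in> ?K"
          using yc r_minus[of y u] by (simp add: a_inv_def[symmetric])
      qed (use yc in \<open>auto simp: r_distr\<close>)
    qed
    show "nonassoc_ring R" by (rule nonassoc_ring_axioms)
  next
    fix u x assume u: "u \<in> ?K" and x: "x \<in> carrier R"
    have "y \<otimes> (x \<otimes> u) = x \<otimes> (y \<otimes> u)" using center_assoc(4)[OF y x, of u] u
      by (metis (no_types, lifting) mem_Collect_eq)
    then show "x \<otimes> u \<in> ?K" using u x by simp
    have "y \<otimes> (u \<otimes> x) = y \<otimes> u \<otimes> x" using center_assoc(1)[OF y _ x, of u] u by simp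
    then show "u \<otimes> x \<in> ?K" using u x by simp
  qed
  moreover have "{commutator R a b | a b. a \<in> carrier R \<and> b \<in> carrier R} \<subseteq> ?K"
    using yc comm by (auto simp: commutator_def mult_minus_distr minus_eq_zero_iff)
  ultimately have "commutator_ideal R \<subseteq> ?K"
    unfolding commutator_ideal_def by blast
  then show ?thesis using y unfolding annihilator_def by blast
qed

end

section \<open>The ring of symmetric central elements and its ideal \<open>symm_ann\<close>\<close>

context ring_involution
begin

text \<open>\<open>symm\<close> and \<open>symm_ann\<close> are the sets \<open>B\<close> and
  \<open>J\<close> of the theorem.\<close>

abbreviation "symm \<equiv> symmetric_center A s"

abbreviation "symm_ann \<equiv> annihilator A symm {a \<ominus> s a | a. a \<in> carrier A}"

lemma symm_iff: "x \<in> symm \<longleftrightarrow> x \<in> ring_center A \<and> s x = x"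
  by (auto simp: symmetric_center_def)

lemma symm_closed: "x \<in> symm \<Longrightarrow> x \<in> carrier A"
  by (simp add: symm_iff center_closed)

lemma symm_zero: "\<zero> \<in> symm"
  by (simp add: symm_iff mem_ring_center)

lemma symm_mult: "\<lbrakk>x \<in> symm; y \<in> symm\<rbrakk> \<Longrightarrow> x \<otimes> y \<in> symm"
proof -
  interpret B: cring "A\<lparr>carrier := symm\<rparr>" by (rule cring_symmetric_center)
  show "\<lbrakk>x \<in> symm; y \<in> symm\<rbrakk> \<Longrightarrow> x \<otimes> y \<in> symm" using B.m_closed by simp
qed

lemma symm_add: "\<lbrakk>x \<in> symm; y \<in> symm\<rbrakk> \<Longrightarrow> x \<oplus> y \<in> symm"
proof -
  interpret B: cring "A\<lparr>carrier := symm\<rparr>" by (rule cring_symmetric_center)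
  show "\<lbrakk>x \<in> symm; y \<in> symm\<rbrakk> \<Longrightarrow> x \<oplus> y \<in> symm" using B.a_closed by simp
qed

text \<open>The inverse in the restricted ring is a definite description over the smaller carrier,
  so it has to be identified with the inverse in \<open>A\<close>; uniqueness of inverses in
  \<open>A\<close> does this.\<close>

lemma symm_a_inv:
  assumes "x \<in> symm"
  shows "\<ominus>\<^bsub>A\<lparr>carrier := symm\<rparr>\<^esub> x = \<ominus> x" and "\<ominus> x \<in> symm"
proof -
  interpret B: cring "A\<lparr>carrier := symm\<rparr>" by (rule cring_symmetric_center)
  show "\<ominus>\<^bsub>A\<lparr>carrier := symm\<rparr>\<^esub> x = \<ominus> x"
    using B.l_neg[of x] B.a_inv_closed[of x] assms
    by (intro minus_equality[symmetric]) (auto simp: symm_closed)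
  then show "\<ominus> x \<in> symm" using B.a_inv_closed[of x] assms by simp
qed

text \<open>Distributing \<open>y\<close> over \<open>a \<ominus> s a\<close> removes the
  subtraction. Later proofs use membership in this form: a factor \<open>y\<close> absorbs the
  involution.\<close>

lemma symm_ann_iff:
  "y \<in> symm_ann \<longleftrightarrow> y \<in> symm \<and> (\<forall>a\<in>carrier A. y \<otimes> s a = y \<otimes> a)"
proof -
  have "y \<otimes> (a \<ominus> s a) = \<zero> \<longleftrightarrow> y \<otimes> s a = y \<otimes> a" if "y \<in> symm" "a \<in> carrier A" for a
    using that by (auto simp: symm_closed mult_minus_distr minus_eq_zero_iff)
  then show ?thesis unfolding annihilator_def by blast
qed

text \<open>The involution, applied to the whole product, reverses the factors; two more
  applications, one to each factor, remove it again. Centrality moves \<open>y\<close> next to the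
  factor concerned.\<close>

lemma symm_ann_comm:
  assumes y: "y \<in> symm_ann" and a: "a \<in> carrier A" and b: "b \<in> carrier A"
  shows "y \<otimes> (a \<otimes> b) = y \<otimes> (b \<otimes> a)"
proof -
  have yC: "y \<in> ring_center A" and ys: "\<And>a. a \<in> carrier A \<Longrightarrow> y \<otimes> s a = y \<otimes> a"
    using y by (auto simp: symm_ann_iff symm_iff)
  have "y \<otimes> (a \<otimes> b) = y \<otimes> (s b \<otimes> s a)"
    using ys[of "a \<otimes> b"] a b by (simp add: inv_mult)
  also have "\<dots> = y \<otimes> s b \<otimes> s a" using a b by (simp add: center_assoc(1)[OF yC])
  also have "\<dots> = y \<otimes> b \<otimes> s a" using a b by (simp add: ys)
  also have "\<dots> = b \<otimes> (y \<otimes> s a)" using a b by (simp add: center_assoc[OF yC])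
  also have "\<dots> = y \<otimes> (b \<otimes> a)" using a b by (simp only: ys center_assoc(4)[OF yC])
  finally show ?thesis .
qed

text \<open>Regrouping puts \<open>y\<close> next to the first factor, where it absorbs
  \<open>s\<close>; commuting under \<open>y\<close> carries this over to the second factor.
  Together with \<open>symm_ann_comm\<close>, products of two elements under \<open>y\<close> behave
  as if \<open>A\<close> were commutative with trivial involution.\<close>

lemma symm_ann_inv:
  assumes y: "y \<in> symm_ann" and a: "a \<in> carrier A" and b: "b \<in> carrier A"
  shows "y \<otimes> (s a \<otimes> b) = y \<otimes> (a \<otimes> b)" and "y \<otimes> (a \<otimes> s b) = y \<otimes> (a \<otimes> b)"
proof -
  have yC: "y \<in> ring_center A" and ys: "\<And>a. a \<in> carrier A \<Longrightarrow> y \<otimes> s a = y \<otimes> a"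
    using y by (auto simp: symm_ann_iff symm_iff)
  have 1: "y \<otimes> (s a \<otimes> b) = y \<otimes> (a \<otimes> b)" if "a \<in> carrier A" "b \<in> carrier A" for a b
    using that by (simp only: inv_closed ys center_assoc(1)[OF yC, symmetric])
  show "y \<otimes> (s a \<otimes> b) = y \<otimes> (a \<otimes> b)" by (rule 1[OF a b])
  show "y \<otimes> (a \<otimes> s b) = y \<otimes> (a \<otimes> b)"
    using a b 1[OF b a] symm_ann_comm[OF y, of a "s b"] symm_ann_comm[OF y, of a b] by simp
qed

text \<open>Elements of \<open>symm_ann\<close> are central and, by \<open>symm_ann_comm\<close>,
  kill all commutators. In the theorem this inclusion turns \<open>I \<inter> J\<close> into
  \<open>symm_ann\<close>.\<close>

lemma symm_ann_subset_annihilator: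
  "symm_ann \<subseteq> annihilator A (ring_center A) (commutator_ideal A)"
proof
  fix y assume y: "y \<in> symm_ann"
  show "y \<in> annihilator A (ring_center A) (commutator_ideal A)"
    by (rule center_annihilates_commutator_ideal)
      (use y in \<open>auto simp: symm_ann_iff symm_iff symm_ann_comm[OF y]\<close>)
qed

lemma symm_ann_mult:
  assumes x: "x \<in> symm" and y: "y \<in> symm_ann"
  shows "x \<otimes> y \<in> symm_ann"
proof -
  have "x \<otimes> y \<otimes> a = x \<otimes> (y \<otimes> a)" if "a \<in> carrier A" for a
    using assms that center_assoc(1)[of x y a] by (auto simp: symm_ann_iff symm_iff center_closed)
  then show ?thesis using assms by (simp add: symm_ann_iff symm_mult)
qed

lemma ideal_symm_ann: "ideal symm_ann (A\<lparr>carrier := symm\<rparr>)"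
proof -
  interpret B: cring "A\<lparr>carrier := symm\<rparr>" by (rule cring_symmetric_center)
  show ?thesis
  proof (rule idealI)
    show "ring (A\<lparr>carrier := symm\<rparr>)" by (rule B.ring_axioms)
    show "subgroup symm_ann (add_monoid (A\<lparr>carrier := symm\<rparr>))"
    proof
      fix x assume x: "x \<in> symm_ann"
      then have "\<ominus> x \<in> symm_ann"
        by (auto simp: symm_ann_iff symm_a_inv(2) symm_closed l_minus)
      then show "inv\<^bsub>add_monoid (A\<lparr>carrier := symm\<rparr>)\<^esub> x \<in> symm_ann"
        using symm_a_inv(1)[of x] x by (simp add: a_inv_def symm_ann_iff)
    qed (auto simp: symm_ann_iff symm_add symm_zero symm_closed l_distr)
  next
    fix x y assume xy: "x \<in> symm_ann" "y \<in> carrier (A\<lparr>carrier := symm\<rparr>)"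
    then show "y \<otimes>\<^bsub>A\<lparr>carrier := symm\<rparr>\<^esub> x \<in> symm_ann" by (simp add: symm_ann_mult)
    moreover have "x \<otimes> y = y \<otimes> x" using xy B.m_comm[of x y] by (simp add: symm_ann_iff)
    ultimately show "x \<otimes>\<^bsub>A\<lparr>carrier := symm\<rparr>\<^esub> y \<in> symm_ann" by simp
  qed
qed

section \<open>\<open>A\<close> as a module over \<open>symm\<close>\<close>

lemma regular_module_a_inv: "\<ominus>\<^bsub>regular_module A\<^esub> x = \<ominus> x"
  by (simp add: a_inv_def regular_module_def m_inv_def)

lemma submodule_symm: "submodule symm (A\<lparr>carrier := symm\<rparr>) (regular_module A)"
proof -
  interpret M: module "A\<lparr>carrier := symm\<rparr>" "regular_module A" by (rule module_regular_module)
  show ?thesis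
    by (rule M.submoduleI)
      (auto simp: regular_module_a_inv symm_a_inv(2) symm_closed,
       auto simp: regular_module_def symm_zero symm_add symm_mult symm_closed)
qed

text \<open>The cyclic submodule generated by \<open>a\<close> is the one on which essentiality of
  \<open>symm\<close> gets tested.\<close>

lemma submodule_cyclic:
  assumes "a \<in> carrier A"
  shows "submodule {c \<otimes> a | c. c \<in> symm} (A\<lparr>carrier := symm\<rparr>) (regular_module A)"
proof -
  interpret M: module "A\<lparr>carrier := symm\<rparr>" "regular_module A" by (rule module_regular_module)
  show ?thesis
  proof (rule M.submoduleI)
    fix x assume "x \<in> {c \<otimes> a | c. c \<in> symm}"
    then obtain c where "x = c \<otimes> a" "c \<in> symm" by blast
    then have "\<ominus> x = \<ominus> c \<otimes> a" "\<ominus> c \<in> symm" using assms by (simp_all add: l_minus symm_closed symm_a_inv(2))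
    then show "\<ominus>\<^bsub>regular_module A\<^esub> x \<in> {c \<otimes> a | c. c \<in> symm}" unfolding regular_module_a_inv by blast
  next
    fix x y assume "x \<in> {c \<otimes> a | c. c \<in> symm}" "y \<in> {c \<otimes> a | c. c \<in> symm}"
    then obtain c d where "x = c \<otimes> a" "c \<in> symm" "y = d \<otimes> a" "d \<in> symm" by blast
    then have "x \<oplus> y = (c \<oplus> d) \<otimes> a" "c \<oplus> d \<in> symm" using assms by (simp_all add: l_distr symm_closed symm_add)
    then show "x \<oplus>\<^bsub>regular_module A\<^esub> y \<in> {c \<otimes> a | c. c \<in> symm}"
      by (auto simp: regular_module_def)
  next
    fix b x assume "b \<in> carrier (A\<lparr>carrier := symm\<rparr>)" "x \<in> {c \<otimes> a | c. c \<in> symm}"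
    then obtain c where c: "x = c \<otimes> a" "c \<in> symm" and b: "b \<in> symm" by auto
    then have "b \<otimes> x = b \<otimes> c \<otimes> a"
      using assms center_assoc(1)[of b c a] by (simp add: symm_iff center_closed)
    moreover have "b \<otimes> c \<in> symm" using b c by (intro symm_mult)
    ultimately have "b \<otimes> x = b \<otimes> c \<otimes> a" "b \<otimes> c \<in> symm" .
    then show "b \<odot>\<^bsub>regular_module A\<^esub> x \<in> {c \<otimes> a | c. c \<in> symm}"
      by (auto simp: regular_module_def)
  next
    show "{c \<otimes> a | c. c \<in> symm} \<subseteq> carrier (regular_module A)"
      using assms by (auto simp: regular_module_def symm_closed)
    have "\<zero> = \<zero> \<otimes> a" using assms by simp
    then show "\<zero>\<^bsub>regular_module A\<^esub> \<in> {c \<otimes> a | c. c \<in> symm}"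
      using symm_zero by (auto simp: regular_module_def)
  qed
qed

section \<open>The center of the Cayley-Dickson ring\<close>

lemma cayley_dickson_simps [simp]:
  "carrier (cayley_dickson A s \<alpha>) = carrier A \<times> carrier A"
  "(a, b) \<otimes>\<^bsub>cayley_dickson A s \<alpha>\<^esub> (c, d) =
    (a \<otimes> c \<oplus> \<alpha> \<otimes> (d \<otimes> s b), s a \<otimes> d \<oplus> c \<otimes> b)"
  "\<zero>\<^bsub>cayley_dickson A s \<alpha>\<^esub> = (\<zero>, \<zero>)"
  by (simp_all add: cayley_dickson_def)

text \<open>Each component of an identity to be checked is a sum of terms led by one central factor.
  Under \<open>y\<close> and \<open>z\<close> the remaining factors commute and lose their
  involutions, and then both sides agree up to the order of summands.\<close>

lemma cayley_dickson_centerI: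
  assumes \<alpha>: "\<alpha> \<in> symm" and x: "x \<in> symm" and y: "y \<in> symm_ann"
  shows "(x, y) \<in> ring_center (cayley_dickson A s \<alpha>)"
proof -
  interpret R: nonassoc_ring "cayley_dickson A s \<alpha>"
    using \<alpha> by (intro nonassoc_ring_cayley_dickson symm_closed)
  let ?w = "(x, y)"
  \<comment> \<open>Absorbing \<open>\<alpha>\<close> into \<open>z\<close> and \<open>t\<close> leaves every term with one central factor, in front.\<close>
  define z where "z = \<alpha> \<otimes> y"
  have z: "z \<in> symm_ann" using \<alpha> y by (simp add: z_def symm_ann_mult)
  define t where "t = x \<otimes> \<alpha>"
  have t: "t \<in> symm" using \<alpha> x by (simp add: t_def symm_mult)
  have yB: "y \<in> symm" and zB: "z \<in> symm" using y z by (auto simp: symm_ann_iff)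
  note c [simp] = symm_closed[OF x] symm_closed[OF yB] symm_closed[OF zB] symm_closed[OF \<alpha>]
    symm_closed[OF t]
  have [simp]: "s x = x" "s y = y" "s z = z" "s \<alpha> = \<alpha>" "s t = t"
    using x yB zB \<alpha> t by (auto simp: symm_iff)
  have C: "x \<in> ring_center A" "y \<in> ring_center A" "z \<in> ring_center A" "\<alpha> \<in> ring_center A"
    "t \<in> ring_center A"
    using x yB zB \<alpha> t by (auto simp: symm_iff)
  note ys = y[unfolded symm_ann_iff, THEN conjunct2, rule_format]
  note zs = z[unfolded symm_ann_iff, THEN conjunct2, rule_format]
  have \<alpha>x: "\<alpha> \<otimes> (x \<otimes> u) = t \<otimes> u" and x\<alpha>: "x \<otimes> (\<alpha> \<otimes> u) = t \<otimes> u"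
    and \<alpha>y: "\<alpha> \<otimes> (y \<otimes> u) = z \<otimes> u" and y\<alpha>: "y \<otimes> (\<alpha> \<otimes> u) = z \<otimes> u"
    if "u \<in> carrier A" for u
    using that by (simp_all add: z_def t_def center_assoc(1)[OF C(1)] center_assoc(1)[OF C(4)]
        center_assoc(4)[OF C(4)])
  \<comment> \<open>The rules \<open>n\<close> expand sums and involutions and move the central
    factor to the front; the rules \<open>e\<close> then normalize what stands behind
    \<open>y\<close> or \<open>z\<close>.\<close>
  note n = \<alpha>x x\<alpha> \<alpha>y y\<alpha> l_distr r_distr inv_add inv_mult
     center_assoc[OF C(1)] center_assoc[OF C(2)] center_assoc[OF C(3)]
     center_comm[OF C(1)] center_comm[OF C(2)] center_comm[OF C(3)]
  note e = ys zs symm_ann_comm[OF y] symm_ann_comm[OF z] symm_ann_inv[OF y] symm_ann_inv[OF z]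
  have wp: "?w \<otimes>\<^bsub>cayley_dickson A s \<alpha>\<^esub> (a, b) = (x \<otimes> a \<oplus> z \<otimes> b, x \<otimes> b \<oplus> y \<otimes> a)"
    if [simp]: "a \<in> carrier A" "b \<in> carrier A" for a b
    by (simp add: center_comm[OF C(2)] \<alpha>y)
  have pw: "(a, b) \<otimes>\<^bsub>cayley_dickson A s \<alpha>\<^esub> ?w = (x \<otimes> a \<oplus> z \<otimes> b, x \<otimes> b \<oplus> y \<otimes> a)"
    if [simp]: "a \<in> carrier A" "b \<in> carrier A" for a b
    by (simp add: center_comm[OF C(1)] center_comm[OF C(2)] \<alpha>y ys zs a_comm)
  have comm: "?w \<otimes>\<^bsub>cayley_dickson A s \<alpha>\<^esub> p = p \<otimes>\<^bsub>cayley_dickson A s \<alpha>\<^esub> ?w"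
    if "p \<in> carrier A \<times> carrier A" for p
    using that by (cases p) (simp only: wp pw mem_Times_iff fst_conv snd_conv)
  \<comment> \<open>Together with \<open>comm\<close>, the identities \<open>l\<close> and
    \<open>m\<close> suffice for all three positions of \<open>?w\<close>: commuting it to the front
    turns its middle and last positions into \<open>w (p q) = p (w q)\<close>.\<close>
  have l: "(?w \<otimes>\<^bsub>cayley_dickson A s \<alpha>\<^esub> p) \<otimes>\<^bsub>cayley_dickson A s \<alpha>\<^esub> q =
      ?w \<otimes>\<^bsub>cayley_dickson A s \<alpha>\<^esub> (p \<otimes>\<^bsub>cayley_dickson A s \<alpha>\<^esub> q)"
    if p: "p \<in> carrier A \<times> carrier A" and q: "q \<in> carrier A \<times> carrier A" for p q
  proof -
    obtain a b c d where pq: "p = (a, b)" "q = (c, d)" by (cases p, cases q)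
    have [simp]: "a \<in> carrier A" "b \<in> carrier A" "c \<in> carrier A" "d \<in> carrier A"
      using p q pq by auto
    show ?thesis
      unfolding pq wp[OF \<open>a \<in> carrier A\<close> \<open>b \<in> carrier A\<close>]
      by (simp add: n e a_ac)
  qed
  have m: "p \<otimes>\<^bsub>cayley_dickson A s \<alpha>\<^esub> (?w \<otimes>\<^bsub>cayley_dickson A s \<alpha>\<^esub> q) =
      ?w \<otimes>\<^bsub>cayley_dickson A s \<alpha>\<^esub> (p \<otimes>\<^bsub>cayley_dickson A s \<alpha>\<^esub> q)"
    if p: "p \<in> carrier A \<times> carrier A" and q: "q \<in> carrier A \<times> carrier A" for p q
  proof -
    obtain a b c d where pq: "p = (a, b)" "q = (c, d)" by (cases p, cases q)
    have [simp]: "a \<in> carrier A" "b \<in> carrier A" "c \<in> carrier A" "d \<in> carrier A"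
      using p q pq by auto
    show ?thesis
      unfolding pq wp[OF \<open>c \<in> carrier A\<close> \<open>d \<in> carrier A\<close>]
      by (simp add: n e a_ac)
  qed
  show ?thesis
    unfolding R.mem_ring_center
  proof (intro conjI ballI)
    show "?w \<in> carrier (cayley_dickson A s \<alpha>)" by simp
  next
    fix p q
    assume p: "p \<in> carrier (cayley_dickson A s \<alpha>)" and q: "q \<in> carrier (cayley_dickson A s \<alpha>)"
    note pq = R.m_closed[OF p q]
    note p' = p[unfolded cayley_dickson_simps] and q' = q[unfolded cayley_dickson_simps]
      and pq' = pq[unfolded cayley_dickson_simps]
    show "?w \<otimes>\<^bsub>cayley_dickson A s \<alpha>\<^esub> p \<otimes>\<^bsub>cayley_dickson A s \<alpha>\<^esub> q =
      ?w \<otimes>\<^bsub>cayley_dickson A s \<alpha>\<^esub> (p \<otimes>\<^bsub>cayley_dickson A s \<alpha>\<^esub> q)"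
      by (rule l[OF p' q'])
    show "p \<otimes>\<^bsub>cayley_dickson A s \<alpha>\<^esub> ?w \<otimes>\<^bsub>cayley_dickson A s \<alpha>\<^esub> q =
      p \<otimes>\<^bsub>cayley_dickson A s \<alpha>\<^esub> (?w \<otimes>\<^bsub>cayley_dickson A s \<alpha>\<^esub> q)"
      by (simp only: comm[OF p', symmetric] l[OF p' q'] m[OF p' q'])
    show "p \<otimes>\<^bsub>cayley_dickson A s \<alpha>\<^esub> q \<otimes>\<^bsub>cayley_dickson A s \<alpha>\<^esub> ?w =
      p \<otimes>\<^bsub>cayley_dickson A s \<alpha>\<^esub> (q \<otimes>\<^bsub>cayley_dickson A s \<alpha>\<^esub> ?w)"
      by (simp only: comm[OF pq', symmetric] comm[OF q', symmetric] m[OF p' q'])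
  next
    fix p assume "p \<in> carrier (cayley_dickson A s \<alpha>)"
    then show "?w \<otimes>\<^bsub>cayley_dickson A s \<alpha>\<^esub> p = p \<otimes>\<^bsub>cayley_dickson A s \<alpha>\<^esub> ?w"
      by (intro comm) simp
  qed
qed

text \<open>All conditions come from products with \<open>(a, \<zero>)\<close> and
  \<open>(\<zero>, b)\<close>. Commuting with these gives the commutation rules and, at
  \<open>b = \<one>\<close>, the symmetry of \<open>x\<close> and \<open>y\<close>; associators with
  \<open>(a, \<zero>)\<close> and \<open>(b, \<zero>)\<close> give the rest.\<close>

lemma cayley_dickson_centerD:
  assumes \<alpha>: "\<alpha> \<in> ring_center A" "\<alpha> \<in> Units A"
    and w: "(x, y) \<in> ring_center (cayley_dickson A s \<alpha>)"
  shows "x \<in> symm" and "y \<in> symm_ann"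
proof -
  let ?R = "cayley_dickson A s \<alpha>"
  interpret R: nonassoc_ring ?R
    using \<alpha>(1) by (intro nonassoc_ring_cayley_dickson center_closed)
  have [simp]: "\<alpha> \<in> carrier A" using \<alpha>(1) by (rule center_closed)
  have xy [simp]: "x \<in> carrier A" "y \<in> carrier A"
    using w by (auto simp: R.mem_ring_center)
  \<comment> \<open>Cancelling with an inverse \<open>\<beta>\<close> needs the regrouping
    \<open>\<beta> (\<alpha> u) = (\<beta> \<alpha>) u\<close>, which centrality of \<alpha>
    provides.\<close>
  have cancel: "u = v" if "\<alpha> \<otimes> u = \<alpha> \<otimes> v" "u \<in> carrier A" "v \<in> carrier A" for u v
  proof -
    obtain \<beta> where \<beta>: "\<beta> \<in> carrier A" "\<beta> \<otimes> \<alpha> = \<one>" using \<alpha>(2) by (auto simp: Units_def)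
    have "\<beta> \<otimes> (\<alpha> \<otimes> u) = u" if "u \<in> carrier A" for u
      using \<beta> that center_assoc(2,4)[OF \<alpha>(1) \<beta>(1) that] by simp
    then show ?thesis using that by metis
  qed
  have comm: "(x, y) \<otimes>\<^bsub>?R\<^esub> p = p \<otimes>\<^bsub>?R\<^esub> (x, y)" if "p \<in> carrier A \<times> carrier A" for p
    using w that unfolding R.mem_ring_center cayley_dickson_simps(1) by blast
  have assoc: "((x, y) \<otimes>\<^bsub>?R\<^esub> p) \<otimes>\<^bsub>?R\<^esub> q = (x, y) \<otimes>\<^bsub>?R\<^esub> (p \<otimes>\<^bsub>?R\<^esub> q)"
      "(p \<otimes>\<^bsub>?R\<^esub> (x, y)) \<otimes>\<^bsub>?R\<^esub> q = p \<otimes>\<^bsub>?R\<^esub> ((x, y) \<otimes>\<^bsub>?R\<^esub> q)"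
      "(p \<otimes>\<^bsub>?R\<^esub> q) \<otimes>\<^bsub>?R\<^esub> (x, y) = p \<otimes>\<^bsub>?R\<^esub> (q \<otimes>\<^bsub>?R\<^esub> (x, y))"
    if "p \<in> carrier A \<times> carrier A" "q \<in> carrier A \<times> carrier A" for p q
    using w that unfolding R.mem_ring_center cayley_dickson_simps(1) by blast+
  have xc: "x \<otimes> a = a \<otimes> x" and ya: "s a \<otimes> y = a \<otimes> y" if "a \<in> carrier A" for a
    using comm[of "(a, \<zero>)"] that by simp_all
  have \<alpha>y: "\<alpha> \<otimes> (b \<otimes> s y) = \<alpha> \<otimes> (y \<otimes> s b)" and xs: "s x \<otimes> b = x \<otimes> b" if "b \<in> carrier A" for b
    using comm[of "(\<zero>, b)"] that by simp_all
  have yb: "b \<otimes> s y = y \<otimes> s b" if "b \<in> carrier A" for b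
    by (rule cancel[OF \<alpha>y]) (use that in auto)
  have sx: "s x = x" using xs[of \<one>] by simp
  have sy: "s y = y" using yb[of \<one>] by simp
  have ys: "y \<otimes> s a = a \<otimes> y" if "a \<in> carrier A" for a
    using yb[OF that] sy by simp
  have yc: "y \<otimes> a = a \<otimes> y" if "a \<in> carrier A" for a
    using ys[of "s a"] ya[of a] that by simp
  have x1: "x \<otimes> a \<otimes> b = x \<otimes> (a \<otimes> b)" "a \<otimes> x \<otimes> b = a \<otimes> (x \<otimes> b)" "a \<otimes> b \<otimes> x = a \<otimes> (b \<otimes> x)"
    and y1: "b \<otimes> (a \<otimes> y) = a \<otimes> b \<otimes> y"
    if "a \<in> carrier A" "b \<in> carrier A" for a b
    using assoc[of "(a, \<zero>)" "(b, \<zero>)"] that by simp_all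
  \<comment> \<open>The second component of the middle associator, taken at \<open>s a\<close> so
    that the involutions cancel, reads \<open>b (a y) = a (b y)\<close>; by \<open>y1\<close> the
    left side is \<open>(a b) y\<close>.\<close>
  have y2: "a \<otimes> b \<otimes> y = a \<otimes> (b \<otimes> y)" if "a \<in> carrier A" "b \<in> carrier A" for a b
    using assoc(2)[of "(s a, \<zero>)" "(b, \<zero>)"] y1 that by simp
  \<comment> \<open>The involution reverses products and fixes \<open>y\<close>, so it carries
    \<open>y\<close> from the last place in \<open>y2\<close> to the first.\<close>
  have y3: "y \<otimes> a \<otimes> b = y \<otimes> (a \<otimes> b)" if "a \<in> carrier A" "b \<in> carrier A" for a b
  proof -
    have "s (s b \<otimes> s a \<otimes> y) = s (s b \<otimes> (s a \<otimes> y))" using y2[of "s b" "s a"] that by simp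
    then show ?thesis using that by (simp only: inv_mult inv_closed inv_inv m_closed sy xy)
  qed
  have y4: "a \<otimes> y \<otimes> b = a \<otimes> (y \<otimes> b)" if "a \<in> carrier A" "b \<in> carrier A" for a b
    using that y2[OF that] y3[OF that] yc[of a] yc[of b] yc[of "a \<otimes> b"] by simp
  show "x \<in> symm"
    unfolding symm_iff mem_ring_center using xc x1 sx by simp
  show "y \<in> symm_ann"
    unfolding symm_ann_iff symm_iff mem_ring_center using sy yc ys y2 y3 y4 by simp
qed

lemma ring_center_cayley_dickson:
  assumes "\<alpha> \<in> symm" "\<alpha> \<in> Units A"
  shows "ring_center (cayley_dickson A s \<alpha>) = symm \<times> symm_ann"
proof -
  have "\<alpha> \<in> ring_center A" using assms(1) by (simp add: symm_iff)
  note D = cayley_dickson_centerD[OF this assms(2)]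
  have "w \<in> ring_center (cayley_dickson A s \<alpha>) \<longleftrightarrow> w \<in> symm \<times> symm_ann" for w
    using D cayley_dickson_centerI[OF assms(1)] by (cases w) blast
  then show ?thesis by blast
qed

section \<open>Central essentiality and the two essentiality conditions\<close>

lemma essential_submodule_symmD:
  assumes "essential_submodule (A\<lparr>carrier := symm\<rparr>) (regular_module A) symm"
    and "a \<in> carrier A" "a \<noteq> \<zero>"
  obtains x where "x \<in> symm" "x \<otimes> a \<in> symm" "x \<otimes> a \<noteq> \<zero>"
proof -
  let ?K = "{c \<otimes> a | c. c \<in> symm}"
  have "\<one> \<in> symm" by (simp add: symm_iff mem_ring_center)
  then have "a \<in> ?K" using assms(2) l_one[of a] by force
  then have "?K \<noteq> {\<zero>}" using assms(3) by blast
  then have "symm \<inter> ?K \<noteq> {\<zero>}"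
    using assms(1) submodule_cyclic[OF assms(2)] unfolding essential_submodule_def
    by (simp add: regular_module_def)
  \<comment> \<open>Since \<open>\<zero>\<close> lies in the intersection, differing from
    \<open>{\<zero>}\<close> means having a nonzero element; the empty set is excluded.\<close>
  moreover have "\<zero> \<in> symm \<inter> ?K" using symm_zero assms(2) l_null[of a] by force
  ultimately show thesis using that by blast
qed

text \<open>Essentiality is tested on the principal ideal of \<open>symm\<close> generated by
  \<open>a\<close>.\<close>

lemma essential_ideal_symm_annD:
  assumes "essential_ideal (A\<lparr>carrier := symm\<rparr>) symm_ann"
    and "a \<in> symm" "a \<noteq> \<zero>"
  obtains x where "x \<in> symm" "x \<otimes> a \<in> symm_ann" "x \<otimes> a \<noteq> \<zero>"
proof -
  interpret B: cring "A\<lparr>carrier := symm\<rparr>" by (rule cring_symmetric_center)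
  let ?K = "PIdl\<^bsub>A\<lparr>carrier := symm\<rparr>\<^esub> a"
  have K: "?K = {c \<otimes> a | c. c \<in> symm}" by (simp add: cgenideal_def)
  have "ideal ?K (A\<lparr>carrier := symm\<rparr>)" and "a \<in> ?K"
    using assms(2) by (auto intro: B.cgenideal_ideal B.cgenideal_self)
  then have "symm_ann \<inter> ?K \<noteq> {\<zero>}"
    using assms(1,3) unfolding essential_ideal_def by auto
  moreover have "\<zero> \<in> symm_ann \<inter> ?K"
    using symm_zero symm_closed[OF assms(2)] l_null[of a] unfolding K Int_iff symm_ann_iff by force
  ultimately show thesis using that unfolding K by blast
qed

text \<open>With the center known to be \<open>symm \<times> symm_ann\<close>, central essentiality
  is unpacked into coordinates; both directions of the equivalence below work with this
  form.\<close>

lemma centrally_essential_cayley_dickson_iff: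
  assumes \<alpha>: "\<alpha> \<in> symm" "\<alpha> \<in> Units A"
  shows "centrally_essential (cayley_dickson A s \<alpha>) \<longleftrightarrow>
    (\<forall>a\<in>carrier A. \<forall>b\<in>carrier A. (a, b) \<noteq> (\<zero>, \<zero>) \<longrightarrow>
      (\<exists>x\<in>symm. \<exists>y\<in>symm_ann. x \<otimes> a \<oplus> \<alpha> \<otimes> (y \<otimes> b) \<in> symm \<and> x \<otimes> b \<oplus> y \<otimes> a \<in> symm_ann \<and>
        (x \<otimes> a \<oplus> \<alpha> \<otimes> (y \<otimes> b), x \<otimes> b \<oplus> y \<otimes> a) \<noteq> (\<zero>, \<zero>)))"
proof -
  let ?R = "cayley_dickson A s \<alpha>"
  interpret R: nonassoc_ring ?R
    using \<alpha> by (intro nonassoc_ring_cayley_dickson symm_closed)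
  have prod: "(x, y) \<otimes>\<^bsub>?R\<^esub> (a, b) = (x \<otimes> a \<oplus> \<alpha> \<otimes> (y \<otimes> b), x \<otimes> b \<oplus> y \<otimes> a)"
    if "x \<in> symm" "y \<in> symm_ann" "a \<in> carrier A" "b \<in> carrier A" for x y a b
    using that center_comm[of y a] center_comm[of y b] by (simp add: symm_ann_iff symm_iff)
  have ess: "{z \<otimes>\<^bsub>?R\<^esub> r | z. z \<in> ring_center ?R} \<inter> ring_center ?R \<noteq> {\<zero>\<^bsub>?R\<^esub>} \<longleftrightarrow>
      (\<exists>z\<in>ring_center ?R. z \<otimes>\<^bsub>?R\<^esub> r \<in> ring_center ?R \<and> z \<otimes>\<^bsub>?R\<^esub> r \<noteq> \<zero>\<^bsub>?R\<^esub>)"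
    (is "?L \<inter> ?Z \<noteq> _ \<longleftrightarrow> _") if "r \<in> carrier ?R" for r
  proof -
    have "\<zero>\<^bsub>?R\<^esub> \<in> ?Z" by (simp only: R.mem_ring_center) (auto simp del: cayley_dickson_simps)
    moreover have "\<zero>\<^bsub>?R\<^esub> \<in> ?L"
      using calculation R.l_null[OF that] by (metis (mono_tags, lifting) mem_Collect_eq)
    ultimately show ?thesis by blast
  qed
  have "centrally_essential ?R \<longleftrightarrow> (\<forall>r\<in>carrier ?R. r \<noteq> \<zero>\<^bsub>?R\<^esub> \<longrightarrow>
      (\<exists>z\<in>ring_center ?R. z \<otimes>\<^bsub>?R\<^esub> r \<in> ring_center ?R \<and> z \<otimes>\<^bsub>?R\<^esub> r \<noteq> \<zero>\<^bsub>?R\<^esub>))"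
    unfolding centrally_essential_def using ess by blast
  also have "\<dots> \<longleftrightarrow> (\<forall>a\<in>carrier A. \<forall>b\<in>carrier A. (a, b) \<noteq> (\<zero>, \<zero>) \<longrightarrow>
      (\<exists>x\<in>symm. \<exists>y\<in>symm_ann. (x, y) \<otimes>\<^bsub>?R\<^esub> (a, b) \<in> symm \<times> symm_ann \<and>
        (x, y) \<otimes>\<^bsub>?R\<^esub> (a, b) \<noteq> (\<zero>, \<zero>)))"
    unfolding ring_center_cayley_dickson[OF \<alpha>] cayley_dickson_simps(1,3) Ball_def Bex_def
    by (simp only: split_paired_All split_paired_Ex mem_Times_iff fst_conv snd_conv) blast
  finally show ?thesis
    by (simp add: prod del: cayley_dickson_simps cong: ball_cong bex_cong)
qed

lemma centrally_essential_cayley_dickson: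
  assumes \<alpha>: "\<alpha> \<in> symm" "\<alpha> \<in> Units A"
  shows "centrally_essential (cayley_dickson A s \<alpha>) \<longleftrightarrow>
    essential_submodule (A\<lparr>carrier := symm\<rparr>) (regular_module A) symm \<and>
    essential_ideal (A\<lparr>carrier := symm\<rparr>) symm_ann"
proof -
  have \<alpha>c: "\<alpha> \<in> carrier A" using \<alpha>(1) by (rule symm_closed)
  have J_symm: "symm_ann \<subseteq> symm" by (auto simp: symm_ann_iff)
  have J_zero: "\<zero> \<in> symm_ann" by (simp add: symm_ann_iff symm_zero)
  note essR = centrally_essential_cayley_dickson_iff[OF \<alpha>]
  have annC: "a \<otimes> y = y \<otimes> a" if "y \<in> symm_ann" "a \<in> carrier A" for a y
    using that center_comm[of y a] by (simp add: symm_ann_iff symm_iff)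
  show ?thesis
  proof (intro iffI conjI)
    assume ce: "centrally_essential (cayley_dickson A s \<alpha>)"
    show "essential_submodule (A\<lparr>carrier := symm\<rparr>) (regular_module A) symm"
      unfolding essential_submodule_def
    proof (intro conjI allI impI submodule_symm)
      fix K assume K: "submodule K (A\<lparr>carrier := symm\<rparr>) (regular_module A)"
        and K0: "K \<noteq> {\<zero>\<^bsub>regular_module A\<^esub>}"
      interpret K: submodule K "A\<lparr>carrier := symm\<rparr>" "regular_module A" by (rule K)
      have Kc: "K \<subseteq> carrier A" using K.subset by (simp add: regular_module_def)
      have KZ: "\<zero> \<in> K" using K.one_closed by (simp add: regular_module_def)
      have Km: "x \<otimes> a \<in> K" if "x \<in> symm" "a \<in> K" for x a
        using K.smult_closed[of x a] that by (simp add: regular_module_def)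
      obtain a where a: "a \<in> K" "a \<noteq> \<zero>" using K0 KZ by (auto simp: regular_module_def)
      then have ac [simp]: "a \<in> carrier A" using Kc by blast
      \<comment> \<open>At \<open>(a, \<zero>)\<close> the central multiple is
        \<open>(x a, y a)\<close>. Both entries lie in \<open>symm\<close> and in \<open>K\<close>,
        and whichever is nonzero serves.\<close>
      obtain x y where xy: "x \<in> symm" "y \<in> symm_ann"
        and m: "x \<otimes> a \<in> symm" "y \<otimes> a \<in> symm_ann" "(x \<otimes> a, y \<otimes> a) \<noteq> (\<zero>, \<zero>)"
        using ce[unfolded essR, rule_format, of a \<zero>] a(2) \<alpha>c by (auto simp: symm_closed symm_ann_iff)
      have "x \<otimes> a \<in> symm \<inter> K" "y \<otimes> a \<in> symm \<inter> K"
        using xy m(1,2) J_symm a(1) Km by blast+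
      then show "symm \<inter> K \<noteq> {\<zero>\<^bsub>regular_module A\<^esub>}"
        using m(3) by (auto simp: regular_module_def)
    qed
    show "essential_ideal (A\<lparr>carrier := symm\<rparr>) symm_ann"
      unfolding essential_ideal_def
    proof (intro conjI allI impI ideal_symm_ann)
      fix K assume K: "ideal K (A\<lparr>carrier := symm\<rparr>)" and K0: "K \<noteq> {\<zero>\<^bsub>A\<lparr>carrier := symm\<rparr>\<^esub>}"
      interpret K: ideal K "A\<lparr>carrier := symm\<rparr>" by (rule K)
      have KZ: "\<zero> \<in> K" using additive_subgroup.zero_closed[OF ideal.axioms(1)[OF K]] by simp
      have Km: "x \<otimes> b \<in> K" if "x \<in> symm" "b \<in> K" for x b
        using K.I_l_closed[of b x] that by simp
      obtain b where b: "b \<in> K" "b \<noteq> \<zero>" using K0 KZ by auto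
      then have bB: "b \<in> symm" using K.a_subset by auto
      then have [simp]: "b \<in> carrier A" by (rule symm_closed)
      \<comment> \<open>At \<open>(\<zero>, b)\<close> the central multiple is
        \<open>(\<alpha> (y b), x b)\<close>. If the first entry is the nonzero one, then
        \<open>y b\<close> is nonzero and lies in \<open>symm_ann\<close> because \<open>y\<close>
        does.\<close>
      obtain x y where xy: "x \<in> symm" "y \<in> symm_ann"
        and m: "x \<otimes> b \<in> symm_ann" "(\<alpha> \<otimes> (y \<otimes> b), x \<otimes> b) \<noteq> (\<zero>, \<zero>)"
        using ce[unfolded essR, rule_format, of \<zero> b] b(2) \<alpha>c by (auto simp: symm_closed symm_ann_iff)
      have "y \<otimes> b \<in> symm_ann" using symm_ann_mult[OF bB xy(2)] annC[OF xy(2), of b] by simp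
      then have "x \<otimes> b \<in> symm_ann \<inter> K" "y \<otimes> b \<in> symm_ann \<inter> K"
        using xy m(1) J_symm b(1) Km by blast+
      moreover have "x \<otimes> b \<noteq> \<zero> \<or> y \<otimes> b \<noteq> \<zero>" using m(2) \<alpha>c by auto
      ultimately show "symm_ann \<inter> K \<noteq> {\<zero>\<^bsub>A\<lparr>carrier := symm\<rparr>\<^esub>}" by auto
    qed
  next
    assume "essential_submodule (A\<lparr>carrier := symm\<rparr>) (regular_module A) symm \<and>
      essential_ideal (A\<lparr>carrier := symm\<rparr>) symm_ann"
    then have sub: "essential_submodule (A\<lparr>carrier := symm\<rparr>) (regular_module A) symm"
      and ide: "essential_ideal (A\<lparr>carrier := symm\<rparr>) symm_ann" by auto
    have mult: "u \<otimes> x \<otimes> a = u \<otimes> (x \<otimes> a)" if "u \<in> symm" "x \<in> symm" "a \<in> carrier A" for u x a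
      using that center_assoc(1)[of u x a] by (simp add: symm_iff center_closed)
    \<comment> \<open>The essential submodule moves \<open>a\<close> into \<open>symm\<close>, then
      the essential ideal moves the result into \<open>symm_ann\<close>.\<close>
    have scale: "\<exists>x\<in>symm. x \<otimes> a \<in> symm_ann \<and> x \<otimes> a \<noteq> \<zero>"
      if a: "a \<in> carrier A" "a \<noteq> \<zero>" for a
    proof -
      obtain x where x: "x \<in> symm" "x \<otimes> a \<in> symm" "x \<otimes> a \<noteq> \<zero>"
        using essential_submodule_symmD[OF sub a] .
      obtain u where u: "u \<in> symm" "u \<otimes> (x \<otimes> a) \<in> symm_ann" "u \<otimes> (x \<otimes> a) \<noteq> \<zero>"
        using essential_ideal_symm_annD[OF ide x(2,3)] .
      show ?thesis
        using mult[OF u(1) x(1) a(1)] u x(1) by (intro bexI[of _ "u \<otimes> x"] symm_mult) auto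
    qed
    have both: "\<exists>x\<in>symm. x \<otimes> a \<in> symm_ann \<and> x \<otimes> b \<in> symm_ann \<and> (x \<otimes> a \<noteq> \<zero> \<or> x \<otimes> b \<noteq> \<zero>)"
      if a: "a \<in> carrier A" and b: "b \<in> carrier A" and ab: "a \<noteq> \<zero> \<or> b \<noteq> \<zero>" for a b
    proof (cases "a = \<zero>")
      case True
      then obtain x where "x \<in> symm" "x \<otimes> b \<in> symm_ann" "x \<otimes> b \<noteq> \<zero>" using scale b ab by blast
      then show ?thesis using True J_zero by (auto simp: symm_closed)
    next
      case False
      then obtain x where x: "x \<in> symm" "x \<otimes> a \<in> symm_ann" "x \<otimes> a \<noteq> \<zero>" using scale a by blast
      show ?thesis
      proof (cases "x \<otimes> b = \<zero>")
        case True
        then show ?thesis using x J_zero by auto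
      next
        case False
        moreover have "x \<otimes> b \<in> carrier A" using x(1) b by (simp add: symm_closed)
        \<comment> \<open>The second scaling keeps \<open>x b\<close> nonzero. It may kill
          \<open>x a\<close>, but \<open>u (x a)\<close> stays in \<open>symm_ann\<close>, which
          absorbs multiplication by \<open>symm\<close>.\<close>
        ultimately obtain u where u: "u \<in> symm" "u \<otimes> (x \<otimes> b) \<in> symm_ann" "u \<otimes> (x \<otimes> b) \<noteq> \<zero>"
          using scale by blast
        show ?thesis
          using mult[OF u(1) x(1)] a b u x(1) symm_ann_mult[OF u(1) x(2)]
          by (intro bexI[of _ "u \<otimes> x"] symm_mult) auto
      qed
    qed
    show "centrally_essential (cayley_dickson A s \<alpha>)"
      unfolding essR
    proof (intro ballI impI)
      fix a b assume ab: "a \<in> carrier A" "b \<in> carrier A" "(a, b) \<noteq> (\<zero>, \<zero>)"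
      obtain x where x: "x \<in> symm" "x \<otimes> a \<in> symm_ann" "x \<otimes> b \<in> symm_ann"
        "x \<otimes> a \<noteq> \<zero> \<or> x \<otimes> b \<noteq> \<zero>"
        using both ab by blast
      \<comment> \<open>The multiplier is \<open>(x, \<zero>)\<close>, which acts on both components
        separately.\<close>
      then show "\<exists>x\<in>symm. \<exists>y\<in>symm_ann. x \<otimes> a \<oplus> \<alpha> \<otimes> (y \<otimes> b) \<in> symm \<and>
          x \<otimes> b \<oplus> y \<otimes> a \<in> symm_ann \<and>
          (x \<otimes> a \<oplus> \<alpha> \<otimes> (y \<otimes> b), x \<otimes> b \<oplus> y \<otimes> a) \<noteq> (\<zero>, \<zero>)"
        using ab J_symm \<alpha>c by (intro bexI[OF _ x(1)] bexI[OF _ J_zero]) (auto simp: symm_closed)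
    qed
  qed
qed

end

theorem theorem1p4:
  fixes A :: "('a, 'm) ring_scheme" and s :: "'a \<Rightarrow> 'a" and \<alpha> :: 'a
    and R :: "('a \<times> 'a) ring" and C I B J :: "'a set"
  assumes "ring_involution A s"
    and "\<alpha> \<in> ring_center A" and "\<alpha> \<in> Units A" and "s \<alpha> = \<alpha>"
    and "R = cayley_dickson A s \<alpha>"
    and "C = ring_center A"
    and "I = annihilator A C (commutator_ideal A)"
    and "B = symmetric_center A s"
    and "J = annihilator A B {a \<ominus>\<^bsub>A\<^esub> s a | a. a \<in> carrier A}"
  shows "ring_center R = {(x, y). x \<in> B \<inter> C \<and> y \<in> I \<inter> J} \<and>
    (centrally_essential R \<longleftrightarrow>
      essential_submodule (A\<lparr>carrier := B\<rparr>) (regular_module A) B \<and>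
      essential_ideal (A\<lparr>carrier := B\<rparr>) J)"
proof -
  interpret ring_involution A s by fact
  have \<alpha>: "\<alpha> \<in> symm" "\<alpha> \<in> Units A" using assms(2-4) by (auto simp: symm_iff)
  have B: "B = symm" and J: "J = symm_ann" using assms by simp_all
  \<comment> \<open>The center is known as \<open>symm \<times> symm_ann\<close>; the two
    intersections of the statement are reduced to these factors by \<open>B \<subseteq> C\<close>
    and \<open>J \<subseteq> I\<close>.\<close>
  have "B \<inter> C = symm" using assms(6) by (auto simp: B symm_iff)
  moreover have "I \<inter> J = symm_ann" using assms(6,7) symm_ann_subset_annihilator J by blast
  ultimately have "ring_center R = {(x, y). x \<in> B \<inter> C \<and> y \<in> I \<inter> J}"
    unfolding assms(5) ring_center_cayley_dickson[OF \<alpha>] by auto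
  then show ?thesis
    using centrally_essential_cayley_dickson[OF \<alpha>] by (simp add: assms(5) B J)
qed

end
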